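(* Let $f,g\in\mathbb{C}[x,y]$ and consider the complex planar polynomial ODE $$\dot x=-x+f(x,y),\qquad \dot y=-y+g(x,y),\qquad (x,y)\in\mathbb{C}^2.$$ Define the nonlinearity $\mathbf{f}:\mathbb{S}^1\times\mathbb{C}^2\to\mathbb{C}$, polynomial in $\mathbf{x}\in\mathbb{C}^2$, by $$\mathbf{f}(\boldsymbol{\xi},\mathbf{x}):=f(\mathbf{R}(\boldsymbol{\xi})\mathbf{x})\cos\boldsymbol{\xi}+g(\mathbf{R}(\boldsymbol{\xi})\mathbf{x})\sin\boldsymbol{\xi}.$$ Then for the parabolic PDE $$\mathbf{w}_t=\mathbf{w}_{\boldsymbol{\xi}\boldsymbol{\xi}}+\mathbf{f}(\boldsymbol{\xi},\mathbf{w},\mathbf{w}_{\boldsymbol{\xi}}),\qquad \boldsymbol{\xi}\in\mathbb{S}^1=\mathbb{R}/2\pi\mathbb{Z},$$ with complex-valued $\mathbf{w}$, the complex two-dimensional subspace $X_1=\langle\sin\boldsymbol{\xi},\cos\boldsymbol{\xi}\rangle_{\mathbb{C}}$ is invariant, and the ODE is the exact, error-free Galerkin projection of the PDE onto $X_1$: a function $\mathbf{w}(t,\boldsymbol{\xi})=x(t)\cos\boldsymbol{\xi}+y(t)\sin\boldsymbol{\xi}$ solves the PDE if and only if $(x(t),y(t))$ solves the ODE. In particular, each and every blow-up phenomenon of complex planar polynomial ODEs (every one of which can be written in the form $\dot x=-x+f(x,y)$, $\dot y=-y+g(x,y)$ with suitable $f,g\in\mathbb{C}[x,y]$) occurs in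 such a PDE on the circle, within the invariant subspace $X_1$.
   Context: $\mathbf{R}(\boldsymbol{\xi})$ is the standard rotation by the angle $\boldsymbol{\xi}$: $\mathbf{R}(\boldsymbol{\xi})(p,q)=(p\cos\boldsymbol{\xi}-q\sin\boldsymbol{\xi},\;p\sin\boldsymbol{\xi}+q\cos\boldsymbol{\xi})$, applied to $(p,q)\in\mathbb{C}^2$. In the PDE, $\mathbf{x}=(\mathbf{w},\mathbf{w}_{\boldsymbol{\xi}})$. Blow-up means that a solution becomes unbounded as (complex) time $t$ approaches a finite value $T$. *)

theory Defs
  imports
    "HOL-Analysis.Analysis"
    "HOL-Computational_Algebra.Polynomial"
    "HOL-Library.Function_Algebras"
begin

(* C[x,y] is represented as C[x][y]: the outer variable is y, the inner one x. *)
definition eval2 :: "complex poly poly \<Rightarrow> complex \<times> complex \<Rightarrow> complex" where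
  "eval2 p = (\<lambda>(x, y). poly (poly p [:y:]) x)"

definition rot :: "real \<Rightarrow> complex \<times> complex \<Rightarrow> complex \<times> complex" where
  "rot \<xi> = (\<lambda>(p, q). (p * of_real (cos \<xi>) - q * of_real (sin \<xi>),
                     p * of_real (sin \<xi>) + q * of_real (cos \<xi>)))"

definition nonlin :: "complex poly poly \<Rightarrow> complex poly poly \<Rightarrow> real \<Rightarrow> complex \<times> complex \<Rightarrow> complex" where
  "nonlin f g \<xi> z = eval2 f (rot \<xi> z) * of_real (cos \<xi>) + eval2 g (rot \<xi> z) * of_real (sin \<xi>)"

(* Functions on the circle R/(2 pi Z) are 2 pi-periodic functions on the real line. *)
definition circle_periodic :: "(real \<Rightarrow> 'a) \<Rightarrow> bool" where
  "circle_periodic u \<longleftrightarrow> (\<forall>\<xi>. u (\<xi> + 2 * pi) = u \<xi>)"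

definition cscale :: "complex \<Rightarrow> (real \<Rightarrow> complex) \<Rightarrow> real \<Rightarrow> complex" where
  "cscale c u = (\<lambda>\<xi>. c * u \<xi>)"

interpretation circle_fun: vector_space cscale
  by unfold_locales (auto simp: cscale_def fun_eq_iff algebra_simps)

definition X1 :: "(real \<Rightarrow> complex) set" where
  "X1 = circle_fun.span {\<lambda>\<xi>. of_real (sin \<xi>), \<lambda>\<xi>. of_real (cos \<xi>)}"

definition mode :: "complex \<Rightarrow> complex \<Rightarrow> real \<Rightarrow> complex" where
  "mode a b = (\<lambda>\<xi>. a * of_real (cos \<xi>) + b * of_real (sin \<xi>))"

definition dxi :: "(real \<Rightarrow> complex) \<Rightarrow> real \<Rightarrow> complex" where
  "dxi u = (\<lambda>\<xi>. vector_derivative u (at \<xi>))"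

definition pde_rhs :: "(real \<Rightarrow> complex \<times> complex \<Rightarrow> complex) \<Rightarrow> (real \<Rightarrow> complex) \<Rightarrow> real \<Rightarrow> complex" where
  "pde_rhs F u = (\<lambda>\<xi>. dxi (dxi u) \<xi> + F \<xi> (u \<xi>, dxi u \<xi>))"

(* Time is complex, and the time derivative is taken relative to the time set D. If D is open,
   this is the complex derivative; if D is the image of a real interval, it is the ordinary
   (at end points: one-sided) derivative with respect to real time. *)

definition ode_solution ::
  "(complex \<times> complex \<Rightarrow> complex) \<Rightarrow> (complex \<times> complex \<Rightarrow> complex) \<Rightarrow> complex set
    \<Rightarrow> (complex \<Rightarrow> complex) \<Rightarrow> (complex \<Rightarrow> complex) \<Rightarrow> bool" where
  "ode_solution P Q D x y \<longleftrightarrow>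
    (\<forall>t\<in>D. (x has_field_derivative P (x t, y t)) (at t within D) \<and>
           (y has_field_derivative Q (x t, y t)) (at t within D))"

(* Classical solutions of w_t = w_xixi + F(xi, w, w_xi) on the circle. The time derivative is
   jointly continuous as well whenever F is, by the equation. *)
definition pde_solution ::
  "(real \<Rightarrow> complex \<times> complex \<Rightarrow> complex) \<Rightarrow> complex set \<Rightarrow> (complex \<Rightarrow> real \<Rightarrow> complex) \<Rightarrow> bool" where
  "pde_solution F D w \<longleftrightarrow>
    (\<forall>t\<in>D. circle_periodic (w t)) \<and>
    (\<forall>t\<in>D. \<forall>\<xi>. w t differentiable (at \<xi>) \<and> dxi (w t) differentiable (at \<xi>)) \<and>
    continuous_on (D \<times> UNIV) (\<lambda>(t, \<xi>). w t \<xi>) \<and>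
    continuous_on (D \<times> UNIV) (\<lambda>(t, \<xi>). dxi (w t) \<xi>) \<and>
    continuous_on (D \<times> UNIV) (\<lambda>(t, \<xi>). dxi (dxi (w t)) \<xi>) \<and>
    (\<forall>t\<in>D. \<forall>\<xi>. ((\<lambda>s. w s \<xi>) has_field_derivative pde_rhs F (w t) \<xi>) (at t within D))"

(* The L2-orthogonal projection onto X1; the factor 1/pi comes from the fact that cos and sin
   both have squared L2 norm pi on the circle. *)
definition proj_X1 :: "(real \<Rightarrow> complex) \<Rightarrow> real \<Rightarrow> complex" where
  "proj_X1 u = mode (integral {0..2 * pi} (\<lambda>\<xi>. u \<xi> * of_real (cos \<xi>)) / of_real pi)
                    (integral {0..2 * pi} (\<lambda>\<xi>. u \<xi> * of_real (sin \<xi>)) / of_real pi)"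

definition sup_norm :: "(real \<Rightarrow> complex) \<Rightarrow> real" where
  "sup_norm u = (SUP \<xi>. norm (u \<xi>))"

(* The size N t of a solution on D becomes unbounded as t in D approaches the finite time T. *)
definition blows_up :: "complex set \<Rightarrow> (complex \<Rightarrow> real) \<Rightarrow> complex \<Rightarrow> bool" where
  "blows_up D N T \<longleftrightarrow> (\<forall>r>0. \<forall>M. \<exists>t\<in>D. dist t T < r \<and> M < N t)"

end

theory Submission
  imports Defs "HOL-Complex_Analysis.Conformal_Mappings"
begin

text \<open>
  A function \<open>u = a cos + b sin\<close> on the circle satisfies \<open>rot \<xi> (u \<xi>, u' \<xi>) = (a, b)\<close> for every
  \<open>\<xi>\<close> (\<open>rot_mode\<close>): the nonlinearity undoes the rotation of the pair \<open>(u, u')\<close> and evaluates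
  \<open>f\<close> and \<open>g\<close> at constant arguments. As the second derivative acts on the first Fourier modes as
  \<open>- 1\<close>, the right-hand side of the partial differential equation maps the mode with coefficients
  \<open>(a, b)\<close> to the mode with coefficients \<open>(- a + f (a, b), - b + g (a, b))\<close>
  (\<open>pde_rhs_mode\<close>). This one computation gives the exact Galerkin projection and the
  correspondence of solutions (\<open>pde_solution_mode_iff\<close>). Every planar polynomial equation is of
  the required form after adding \<open>x\<close> and \<open>y\<close> to its right-hand sides, and blow-up is the same on
  both sides because the supremum norm of a mode is equivalent to the norm of its coefficients.

  Invariance says more: a solution that starts in the plane does not leave it at later times. Let \<open>V\<close> be the
  component of a solution \<open>W\<close> orthogonal to the plane in \<open>L\<^sup>2\<close>, so that \<open>W - V\<close> is a mode.
  The right-hand side at \<open>W - V\<close> is again a mode, hence orthogonal to \<open>V\<close>, and the energy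
  \<open>\<integral> norm V ^ 2\<close> changes at the rate \<open>2 \<integral> V \<bullet> (V'' + n)\<close>, where primes denote
  derivatives along the circle and \<open>n\<close> is the difference of the nonlinearities at \<open>W\<close> and at
  \<open>W - V\<close>. By the Lipschitz bound for \<open>n\<close> in terms of \<open>V\<close> and \<open>V'\<close>, and by integration by
  parts, this rate is at most a constant times the
  energy (\<open>energy_dissipation\<close>), which therefore stays zero
  (\<open>gronwall_zero\<close>, \<open>X1_invariant_forward\<close>). On an open connected set of complex times the
  solution is holomorphic in time, and the identity theorem extends the result from a short segment
  of forward times to the whole set (\<open>X1_invariant_complex_time\<close>).
\<close>

section \<open>Polynomials in two complex variables\<close>

lemma eval2_0 [simp]: "eval2 0 z = 0"
  by (simp add: eval2_def split_beta)

lemma eval2_pCons: "eval2 (pCons c p) (x, y) = poly c x + y * eval2 p (x, y)"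
  by (simp add: eval2_def)

lemma eval2_add: "eval2 (p + q) z = eval2 p z + eval2 q z"
  by (simp add: eval2_def split_beta)

lemma eval2_mult: "eval2 (p * q) z = eval2 p z * eval2 q z"
  by (simp add: eval2_def split_beta)

lemma eval2_const: "eval2 [:[:c:]:] z = c"
  by (simp add: eval2_def split_beta)

lemma eval2_fst: "eval2 [:[:0, 1:]:] (x, y) = x"
  by (simp add: eval2_def)

lemma eval2_snd: "eval2 [:0, 1:] (x, y) = y"
  by (simp add: eval2_def)

text \<open>
  Existence of the substituted polynomial is enough, since only its values matter; two nested
  inductions follow the representation as polynomials in \<open>y\<close> whose coefficients are polynomials
  in \<open>x\<close>.
\<close>

lemma eval2_compose:
  "\<exists>R. \<forall>z. eval2 R z = eval2 p (eval2 A z, eval2 B z)"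
proof (induction p)
  case 0
  show ?case by (intro exI[of _ 0]) simp
next
  case (pCons c p)
  have "\<exists>R. \<forall>z. eval2 R z = poly c (eval2 A z)"
  proof (induction c)
    case 0
    show ?case by (intro exI[of _ 0]) simp
  next
    case (pCons k c)
    then obtain R where "\<forall>z. eval2 R z = poly c (eval2 A z)" by blast
    then show ?case
      by (intro exI[of _ "[:[:k:]:] + A * R"]) (simp add: eval2_add eval2_mult eval2_const)
  qed
  then obtain R1 where "\<forall>z. eval2 R1 z = poly c (eval2 A z)" by blast
  moreover obtain R2 where "\<forall>z. eval2 R2 z = eval2 p (eval2 A z, eval2 B z)"
    using pCons.IH by blast
  ultimately show ?case
    by (intro exI[of _ "R1 + B * R2"]) (simp add: eval2_add eval2_mult eval2_pCons)
qed

lemma continuous_on_poly_comp: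
  fixes c :: "complex poly"
  assumes "continuous_on S a"
  shows "continuous_on S (\<lambda>s. poly c (a s))"
  by (induction c) (auto intro!: continuous_on_add continuous_on_mult assms continuous_on_const)

lemma continuous_on_eval2 [continuous_intros]:
  assumes "continuous_on S a" "continuous_on S b"
  shows "continuous_on S (\<lambda>s. eval2 p (a s, b s))"
proof (induction p)
  case 0
  show ?case by simp
next
  case (pCons c p)
  show ?case
    unfolding eval2_pCons
    by (intro continuous_on_add continuous_on_mult continuous_on_poly_comp continuous_on_const
        assms pCons.IH)
qed

text \<open>
  The Lipschitz constant of a product involves bounds on the factors. The two lemmas below therefore
  carry a bound \<open>K\<close> through their inductions next to the Lipschitz constant \<open>L\<close>.
\<close>

lemma mult_lipschitz_step:
  fixes y y' u u' :: complex
  assumes "norm y' \<le> R" "norm u \<le> K" "norm (u - u') \<le> L * d" "norm (y - y') \<le> d"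
    and "0 \<le> K" "0 \<le> R" "0 \<le> L" "0 \<le> d"
  shows "norm (y * u - y' * u') \<le> (K + R * L) * d"
proof -
  have "y * u - y' * u' = (y - y') * u + y' * (u - u')"
    by (simp add: algebra_simps)
  then have "norm (y * u - y' * u') \<le> norm (y - y') * norm u + norm y' * norm (u - u')"
    by (metis norm_mult norm_triangle_ineq)
  also have "\<dots> \<le> d * K + R * (L * d)"
    using assms by (intro add_mono mult_mono) auto
  finally show ?thesis
    by (simp add: algebra_simps)
qed

lemma poly_locally_lipschitz:
  fixes c :: "complex poly"
  assumes "0 \<le> R"
  shows "\<exists>K\<ge>0. \<exists>L\<ge>0. \<forall>x x'. norm x \<le> R \<and> norm x' \<le> R \<longrightarrow>
           norm (poly c x) \<le> K \<and> norm (poly c x - poly c x') \<le> L * norm (x - x')"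
proof (induction c)
  case 0
  show ?case by (rule exI[of _ 0]) auto
next
  case (pCons k c)
  then obtain K L where KL: "K \<ge> 0" "L \<ge> 0"
    "\<And>x x'. norm x \<le> R \<Longrightarrow> norm x' \<le> R \<Longrightarrow>
       norm (poly c x) \<le> K \<and> norm (poly c x - poly c x') \<le> L * norm (x - x')"
    by metis
  have "norm (poly (pCons k c) x) \<le> norm k + R * K" if "norm x \<le> R" for x
  proof -
    have "norm (poly (pCons k c) x) \<le> norm k + norm x * norm (poly c x)"
      by (metis norm_mult norm_triangle_ineq poly_pCons)
    also have "\<dots> \<le> norm k + R * K"
      using KL that assms by (intro add_mono mult_mono) auto
    finally show ?thesis .
  qed
  moreover have "norm (poly (pCons k c) x - poly (pCons k c) x') \<le> (K + R * L) * norm (x - x')"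
    if "norm x \<le> R" "norm x' \<le> R" for x x'
    using mult_lipschitz_step[of x' R "poly c x" K "poly c x'" L "norm (x - x')" x] KL that assms
    by simp
  ultimately show ?case
    using KL assms by (intro exI[of _ "norm k + R * K"] exI[of _ "K + R * L"] conjI) auto
qed

lemma eval2_locally_lipschitz:
  assumes "0 \<le> R"
  shows "\<exists>K\<ge>0. \<exists>L\<ge>0. \<forall>x x' y y'.
           norm x \<le> R \<and> norm x' \<le> R \<and> norm y \<le> R \<and> norm y' \<le> R \<longrightarrow>
           norm (eval2 p (x, y)) \<le> K \<and>
           norm (eval2 p (x, y) - eval2 p (x', y')) \<le> L * (norm (x - x') + norm (y - y'))"
proof (induction p)
  case 0
  show ?case by (rule exI[of _ 0]) auto
next
  case (pCons c p)
  then obtain K L where KL: "K \<ge> 0" "L \<ge> 0"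
    "\<And>x x' y y'. norm x \<le> R \<Longrightarrow> norm x' \<le> R \<Longrightarrow> norm y \<le> R \<Longrightarrow> norm y' \<le> R \<Longrightarrow>
       norm (eval2 p (x, y)) \<le> K \<and>
       norm (eval2 p (x, y) - eval2 p (x', y')) \<le> L * (norm (x - x') + norm (y - y'))"
    by metis
  obtain K' L' where KL': "K' \<ge> 0" "L' \<ge> 0"
    "\<And>x x'. norm x \<le> R \<Longrightarrow> norm x' \<le> R \<Longrightarrow>
       norm (poly c x) \<le> K' \<and> norm (poly c x - poly c x') \<le> L' * norm (x - x')"
    using poly_locally_lipschitz[OF assms] by metis
  have "norm (eval2 (pCons c p) (x, y)) \<le> K' + R * K"
    if "norm x \<le> R" "norm y \<le> R" for x y
  proof -
    have "norm (eval2 (pCons c p) (x, y)) \<le> norm (poly c x) + norm y * norm (eval2 p (x, y))"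
      by (metis norm_mult norm_triangle_ineq eval2_pCons)
    also have "\<dots> \<le> K' + R * K"
      using KL KL' that assms by (intro add_mono mult_mono) auto
    finally show ?thesis .
  qed
  moreover have "norm (eval2 (pCons c p) (x, y) - eval2 (pCons c p) (x', y'))
      \<le> (L' + (K + R * L)) * (norm (x - x') + norm (y - y'))"
    if "norm x \<le> R" "norm x' \<le> R" "norm y \<le> R" "norm y' \<le> R" for x x' y y'
  proof -
    let ?d = "norm (x - x') + norm (y - y')"
    have "norm (eval2 (pCons c p) (x, y) - eval2 (pCons c p) (x', y'))
        = norm ((poly c x - poly c x') + (y * eval2 p (x, y) - y' * eval2 p (x', y')))"
      by (simp add: eval2_pCons algebra_simps)
    also have "\<dots> \<le> norm (poly c x - poly c x') + norm (y * eval2 p (x, y) - y' * eval2 p (x', y'))"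
      by (rule norm_triangle_ineq)
    also have "norm (poly c x - poly c x') \<le> L' * norm (x - x')"
      using KL' that by blast
    also have "L' * norm (x - x') \<le> L' * ?d"
      using KL' by (intro mult_left_mono) auto
    also have "norm (y * eval2 p (x, y) - y' * eval2 p (x', y')) \<le> (K + R * L) * ?d"
      using KL that assms by (intro mult_lipschitz_step) auto
    finally show ?thesis
      by (simp add: algebra_simps)
  qed
  ultimately show ?case
    using KL KL' assms
    by (intro exI[of _ "K' + R * K"] exI[of _ "L' + (K + R * L)"] conjI) auto
qed

section \<open>The rotating frame and the plane of first Fourier modes\<close>

text \<open>
  The key identity. For \<open>u = a cos + b sin\<close> the pair \<open>(u, u')\<close> is the fixed vector \<open>(a, b)\<close> seen
  from a frame rotated by \<open>\<xi>\<close>, so rotating back removes the dependence on \<open>\<xi>\<close>.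
\<close>

lemma rot_mode: "rot \<xi> (mode a b \<xi>, mode b (- a) \<xi>) = (a, b)"
proof -
  have 1: "complex_of_real (cos \<xi>) * of_real (cos \<xi>) + of_real (sin \<xi>) * of_real (sin \<xi>) = 1"
    by (simp flip: of_real_mult of_real_add)
  then have "a = a * (complex_of_real (cos \<xi>) * of_real (cos \<xi>) + of_real (sin \<xi>) * of_real (sin \<xi>))"
    "b = b * (complex_of_real (cos \<xi>) * of_real (cos \<xi>) + of_real (sin \<xi>) * of_real (sin \<xi>))"
    by simp_all
  then show ?thesis
    by (simp add: rot_def mode_def algebra_simps)
qed

text \<open>
  Since rotating back gives constant coordinates, the nonlinearity maps the plane into itself without
  creating any higher harmonics: no truncation occurs in the Galerkin projection.
\<close>

lemma nonlin_mode:
  "nonlin f g \<xi> (mode a b \<xi>, mode b (- a) \<xi>) = mode (eval2 f (a, b)) (eval2 g (a, b)) \<xi>"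
  unfolding nonlin_def rot_mode by (simp add: mode_def)

lemma mode_has_vector_derivative: "(mode a b has_vector_derivative mode b (- a) \<xi>) (at \<xi> within S)"
  unfolding mode_def by (auto intro!: derivative_eq_intros simp: has_vector_derivative_def
      scaleR_conv_of_real algebra_simps)

lemma dxi_mode: "dxi (mode a b) = mode b (- a)"
  unfolding dxi_def
  by (rule ext) (rule vector_derivative_at[OF mode_has_vector_derivative])

lemma circle_periodic_mode: "circle_periodic (mode a b)"
  by (simp add: circle_periodic_def mode_def)

lemma mode_0: "mode a b 0 = a"
  by (simp add: mode_def)

lemma mode_pi_half: "mode a b (pi / 2) = b"
  by (simp add: mode_def)

lemma mode_add: "mode a b \<xi> + mode c d \<xi> = mode (a + c) (b + d) \<xi>"
  by (simp add: mode_def algebra_simps)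

lemma pde_rhs_mode:
  "pde_rhs (nonlin f g) (mode a b) = mode (- a + eval2 f (a, b)) (- b + eval2 g (a, b))"
  by (rule ext) (simp add: pde_rhs_def dxi_mode nonlin_mode mode_add)

lemma X1_eq_range_mode: "X1 = {mode a b | a b. True}"
proof -
  have "mode a b - cscale b (\<lambda>\<xi>. of_real (sin \<xi>)) = cscale a (\<lambda>\<xi>. of_real (cos \<xi>))" for a b
    by (simp add: mode_def cscale_def fun_eq_iff)
  moreover have "u = mode a b" if "u - cscale b (\<lambda>\<xi>. of_real (sin \<xi>)) - cscale a (\<lambda>\<xi>. of_real (cos \<xi>)) = 0"
    for u a b
  proof
    fix \<xi>
    from fun_cong[OF that, of \<xi>] show "u \<xi> = mode a b \<xi>"
      by (simp add: mode_def cscale_def algebra_simps)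
  qed
  ultimately show ?thesis
    unfolding X1_def circle_fun.span_breakdown_eq circle_fun.span_empty set_eq_iff
    by (simp add: circle_fun.span_breakdown_eq) (metis diff_self)
qed

lemma mode_in_X1: "mode a b \<in> X1"
  by (auto simp: X1_eq_range_mode)

lemma subspace_X1: "circle_fun.subspace X1"
  unfolding X1_def by (rule circle_fun.subspace_span)

lemma dim_X1: "circle_fun.dim X1 = 2"
proof -
  let ?s = "\<lambda>\<xi>. complex_of_real (sin \<xi>)" and ?c = "\<lambda>\<xi>. complex_of_real (cos \<xi>)"
  have c0: "?c \<noteq> 0"
    by (metis cos_zero of_real_1 zero_fun_apply zero_neq_one)
  have s: "?s \<notin> circle_fun.span {?c}"
  proof
    assume "?s \<in> circle_fun.span {?c}"
    then obtain k where "?s = cscale k ?c"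
      by (auto simp: circle_fun.span_singleton)
    then have "?s (pi / 2) = cscale k ?c (pi / 2)"
      by (rule fun_cong)
    then show False
      by (simp add: cscale_def)
  qed
  have "?s \<noteq> ?c"
    using s circle_fun.span_base by force
  moreover have "circle_fun.independent {?s, ?c}"
    using s c0 by (intro circle_fun.independent_insertI)
      (auto simp: circle_fun.independent_insert circle_fun.independent_empty)
  ultimately show ?thesis
    unfolding X1_def by (simp add: circle_fun.dim_eq_card_independent)
qed

lemma mode_mult_cos_has_integral:
  "((\<lambda>\<xi>. mode a b \<xi> * of_real (cos \<xi>)) has_integral a * of_real pi) {0..2 * pi}"
proof -
  let ?F = "\<lambda>\<xi>. a * of_real (\<xi> / 2 + sin \<xi> * cos \<xi> / 2) + b * of_real (sin \<xi> * sin \<xi> / 2)"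
  have trig: "1 / 2 + (cos \<xi> * cos \<xi> - sin \<xi> * sin \<xi>) / 2 = cos \<xi> * cos \<xi>" for \<xi> :: real
    using sin_cos_squared_add3[of \<xi>] by (simp add: field_simps)
  have "(?F has_vector_derivative mode a b \<xi> * of_real (cos \<xi>)) (at \<xi> within {0..2 * pi})" for \<xi>
  proof -
    have "((\<lambda>\<xi>. \<xi> / 2 + sin \<xi> * cos \<xi> / 2) has_real_derivative
        1 / 2 + (cos \<xi> * cos \<xi> - sin \<xi> * sin \<xi>) / 2) (at \<xi> within {0..2 * pi})"
      by (auto intro!: derivative_eq_intros simp: field_simps)
    then have 1: "((\<lambda>\<xi>. \<xi> / 2 + sin \<xi> * cos \<xi> / 2) has_real_derivative cos \<xi> * cos \<xi>)
        (at \<xi> within {0..2 * pi})"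
      unfolding trig .
    have 2: "((\<lambda>\<xi>. sin \<xi> * sin \<xi> / 2) has_real_derivative sin \<xi> * cos \<xi>) (at \<xi> within {0..2 * pi})"
      by (auto intro!: derivative_eq_intros simp: field_simps)
    have "(?F has_vector_derivative a * of_real (cos \<xi> * cos \<xi>) + b * of_real (sin \<xi> * cos \<xi>))
        (at \<xi> within {0..2 * pi})"
      by (intro has_vector_derivative_add has_vector_derivative_mult_right
          has_vector_derivative_of_real 1 2)
    then show ?thesis
      by (simp add: mode_def algebra_simps)
  qed
  from fundamental_theorem_of_calculus[OF _ this] show ?thesis
    by simp
qed

lemma mode_mult_sin_has_integral:
  "((\<lambda>\<xi>. mode a b \<xi> * of_real (sin \<xi>)) has_integral b * of_real pi) {0..2 * pi}"
proof -
  let ?F = "\<lambda>\<xi>. a * of_real (sin \<xi> * sin \<xi> / 2) + b * of_real (\<xi> / 2 - sin \<xi> * cos \<xi> / 2)"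
  have trig: "1 / 2 - (cos \<xi> * cos \<xi> - sin \<xi> * sin \<xi>) / 2 = sin \<xi> * sin \<xi>" for \<xi> :: real
    using sin_cos_squared_add3[of \<xi>] by (simp add: field_simps)
  have "(?F has_vector_derivative mode a b \<xi> * of_real (sin \<xi>)) (at \<xi> within {0..2 * pi})" for \<xi>
  proof -
    have "((\<lambda>\<xi>. \<xi> / 2 - sin \<xi> * cos \<xi> / 2) has_real_derivative
        1 / 2 - (cos \<xi> * cos \<xi> - sin \<xi> * sin \<xi>) / 2) (at \<xi> within {0..2 * pi})"
      by (auto intro!: derivative_eq_intros simp: field_simps)
    then have 1: "((\<lambda>\<xi>. \<xi> / 2 - sin \<xi> * cos \<xi> / 2) has_real_derivative sin \<xi> * sin \<xi>)
        (at \<xi> within {0..2 * pi})"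
      unfolding trig .
    have 2: "((\<lambda>\<xi>. sin \<xi> * sin \<xi> / 2) has_real_derivative sin \<xi> * cos \<xi>) (at \<xi> within {0..2 * pi})"
      by (auto intro!: derivative_eq_intros simp: field_simps)
    have "(?F has_vector_derivative a * of_real (sin \<xi> * cos \<xi>) + b * of_real (sin \<xi> * sin \<xi>))
        (at \<xi> within {0..2 * pi})"
      by (intro has_vector_derivative_add has_vector_derivative_mult_right
          has_vector_derivative_of_real 1 2)
    then show ?thesis
      by (simp add: mode_def algebra_simps)
  qed
  from fundamental_theorem_of_calculus[OF _ this] show ?thesis
    by simp
qed

lemma proj_X1_mode: "proj_X1 (mode a b) = mode a b"
  using mode_mult_cos_has_integral[of a b] mode_mult_sin_has_integral[of a b]
  by (simp add: proj_X1_def integral_unique)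

lemma norm_rot_le:
  "norm (fst (rot \<xi> (p, q))) \<le> norm p + norm q" "norm (snd (rot \<xi> (p, q))) \<le> norm p + norm q"
proof -
  have *: "norm (p * of_real (cos \<xi>)) \<le> norm p" "norm (p * of_real (sin \<xi>)) \<le> norm p"
    "norm (q * of_real (cos \<xi>)) \<le> norm q" "norm (q * of_real (sin \<xi>)) \<le> norm q"
    by (simp_all add: norm_mult mult_left_le)
  show "norm (fst (rot \<xi> (p, q))) \<le> norm p + norm q"
    using * norm_triangle_ineq4[of "p * of_real (cos \<xi>)" "q * of_real (sin \<xi>)"] by (simp add: rot_def)
  show "norm (snd (rot \<xi> (p, q))) \<le> norm p + norm q"
    using * norm_triangle_ineq[of "p * of_real (sin \<xi>)" "q * of_real (cos \<xi>)"] by (simp add: rot_def)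
qed

lemma rot_diff: "rot \<xi> (p, q) - rot \<xi> (p', q') = rot \<xi> (p - p', q - q')"
  by (simp add: rot_def algebra_simps)

text \<open>
  The constant is uniform in \<open>\<xi>\<close>, because a rotated vector has coordinates bounded by the sum of
  the two old ones; hence also the radius \<open>2 * R\<close> on which the polynomials are controlled.
\<close>

lemma nonlin_locally_lipschitz:
  assumes "0 \<le> R"
  shows "\<exists>L\<ge>0. \<forall>\<xi> p p' q q'.
           norm p \<le> R \<and> norm p' \<le> R \<and> norm q \<le> R \<and> norm q' \<le> R \<longrightarrow>
           norm (nonlin f g \<xi> (p, q) - nonlin f g \<xi> (p', q')) \<le> L * (norm (p - p') + norm (q - q'))"
proof -
  have "0 \<le> 2 * R" using assms by simp
  from eval2_locally_lipschitz[OF this, of f] eval2_locally_lipschitz[OF this, of g]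
  obtain Lf Lg where L: "Lf \<ge> 0" "Lg \<ge> 0"
    and Lf: "\<And>x x' y y'. norm x \<le> 2 * R \<Longrightarrow> norm x' \<le> 2 * R \<Longrightarrow> norm y \<le> 2 * R \<Longrightarrow> norm y' \<le> 2 * R \<Longrightarrow>
       norm (eval2 f (x, y) - eval2 f (x', y')) \<le> Lf * (norm (x - x') + norm (y - y'))"
    and Lg: "\<And>x x' y y'. norm x \<le> 2 * R \<Longrightarrow> norm x' \<le> 2 * R \<Longrightarrow> norm y \<le> 2 * R \<Longrightarrow> norm y' \<le> 2 * R \<Longrightarrow>
       norm (eval2 g (x, y) - eval2 g (x', y')) \<le> Lg * (norm (x - x') + norm (y - y'))"
    by metis
  have "norm (nonlin f g \<xi> (p, q) - nonlin f g \<xi> (p', q'))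
      \<le> (2 * Lf + 2 * Lg) * (norm (p - p') + norm (q - q'))"
    if R: "norm p \<le> R" "norm p' \<le> R" "norm q \<le> R" "norm q' \<le> R" for \<xi> p p' q q'
  proof -
    obtain x y where z: "rot \<xi> (p, q) = (x, y)" by fastforce
    obtain x' y' where z': "rot \<xi> (p', q') = (x', y')" by fastforce
    let ?d = "norm (p - p') + norm (q - q')"
    have b: "norm x \<le> 2 * R" "norm x' \<le> 2 * R" "norm y \<le> 2 * R" "norm y' \<le> 2 * R"
      using norm_rot_le[of \<xi> p q] norm_rot_le[of \<xi> p' q'] R by (simp_all add: z z')
    have "rot \<xi> (p - p', q - q') = (x - x', y - y')"
      using rot_diff[of \<xi> p q p' q'] by (simp add: z z')
    then have d: "norm (x - x') + norm (y - y') \<le> 2 * ?d"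
      using norm_rot_le[of \<xi> "p - p'" "q - q'"] by simp
    have "nonlin f g \<xi> (p, q) - nonlin f g \<xi> (p', q')
       = (eval2 f (x, y) - eval2 f (x', y')) * of_real (cos \<xi>)
       + (eval2 g (x, y) - eval2 g (x', y')) * of_real (sin \<xi>)"
      by (simp add: nonlin_def z z' algebra_simps)
    also have "norm \<dots> \<le> norm ((eval2 f (x, y) - eval2 f (x', y')) * of_real (cos \<xi>))
       + norm ((eval2 g (x, y) - eval2 g (x', y')) * of_real (sin \<xi>))"
      by (rule norm_triangle_ineq)
    also have "\<dots> \<le> norm (eval2 f (x, y) - eval2 f (x', y')) + norm (eval2 g (x, y) - eval2 g (x', y'))"
      by (intro add_mono) (simp_all add: norm_mult mult_left_le)
    also have "\<dots> \<le> Lf * (norm (x - x') + norm (y - y')) + Lg * (norm (x - x') + norm (y - y'))"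
      using b by (intro add_mono Lf Lg)
    also have "\<dots> \<le> Lf * (2 * ?d) + Lg * (2 * ?d)"
      using L d by (intro add_mono mult_left_mono)
    finally show ?thesis
      by (simp add: algebra_simps)
  qed
  then show ?thesis
    using L by (intro exI[of _ "2 * Lf + 2 * Lg"]) auto
qed

lemma continuous_on_nonlin:
  fixes S :: "'a::t2_space set"
  assumes "continuous_on S \<theta>" "continuous_on S p" "continuous_on S q"
  shows "continuous_on S (\<lambda>s. nonlin f g (\<theta> s) (p s, q s))"
  unfolding nonlin_def rot_def prod.case by (intro continuous_intros assms)

lemma circle_periodic_nonlin: "circle_periodic (\<lambda>\<xi>. nonlin f g \<xi> z)"
  by (simp add: circle_periodic_def nonlin_def rot_def)

lemma nonlin_polynomial: "\<exists>P. \<forall>z. nonlin f g \<xi> z = eval2 P z"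
proof -
  let ?c = "[:[:complex_of_real (cos \<xi>):]:]" and ?s = "[:[:complex_of_real (sin \<xi>):]:]"
  let ?x = "[:[:0, 1:]:] :: complex poly poly" and ?y = "[:0, 1:] :: complex poly poly"
  let ?A = "?x * ?c + [:[:- 1:]:] * ?y * ?s" and ?B = "?x * ?s + ?y * ?c"
  have rot: "rot \<xi> z = (eval2 ?A z, eval2 ?B z)" for z
    by (cases z) (simp only: eval2_add eval2_mult eval2_const eval2_fst eval2_snd rot_def prod.case, simp)
  obtain F where F: "\<forall>z. eval2 F z = eval2 f (eval2 ?A z, eval2 ?B z)"
    using eval2_compose by blast
  obtain G where G: "\<forall>z. eval2 G z = eval2 g (eval2 ?A z, eval2 ?B z)"
    using eval2_compose by blast
  show ?thesis
    by (rule exI[of _ "F * ?c + G * ?s"])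
      (simp only: nonlin_def rot eval2_add eval2_mult eval2_const F G, simp)
qed

section \<open>The energy estimate transverse to the plane\<close>

lemma circle_periodic_eqI:
  assumes "circle_periodic u" "circle_periodic v" "\<And>\<xi>. \<xi> \<in> {0..2 * pi} \<Longrightarrow> u \<xi> = v \<xi>"
  shows "u = v"
proof
  fix \<xi> :: real
  interpret u: periodic_fun_simple u "2 * pi"
    using assms(1) by unfold_locales (simp add: circle_periodic_def)
  interpret v: periodic_fun_simple v "2 * pi"
    using assms(2) by unfold_locales (simp add: circle_periodic_def)
  let ?n = "\<lfloor>\<xi> / (2 * pi)\<rfloor>"
  have "of_int ?n * (2 * pi) \<le> \<xi>" "\<xi> \<le> (of_int ?n + 1) * (2 * pi)"
    by (simp_all flip: pos_le_divide_eq pos_divide_le_eq add: less_imp_le)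
  then have "u (\<xi> - of_int ?n * (2 * pi)) = v (\<xi> - of_int ?n * (2 * pi))"
    by (intro assms(3)) (simp add: distrib_right)
  then show "u \<xi> = v \<xi>"
    by (simp only: u.minus_of_int v.minus_of_int)
qed

lemma circle_periodic_dxi:
  assumes "circle_periodic u" "\<And>\<xi>. u differentiable (at \<xi>)"
  shows "circle_periodic (dxi u)"
  unfolding circle_periodic_def
proof
  fix \<xi>
  have "(u has_vector_derivative dxi u (\<xi> + 2 * pi)) (at (\<xi> + 2 * pi))"
    using assms(2) unfolding dxi_def by (simp add: vector_derivative_works)
  moreover have "((\<lambda>\<xi>. \<xi> + 2 * pi) has_vector_derivative 1) (at \<xi>)"
    by (simp add: has_vector_derivative_add_const has_vector_derivative_id)
  ultimately have "((\<lambda>\<xi>. u (\<xi> + 2 * pi)) has_vector_derivative dxi u (\<xi> + 2 * pi)) (at \<xi>)"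
    using vector_diff_chain_at[of "\<lambda>\<xi>. \<xi> + 2 * pi" 1 \<xi> u "dxi u (\<xi> + 2 * pi)"]
    by (simp add: o_def)
  then have "(u has_vector_derivative dxi u (\<xi> + 2 * pi)) (at \<xi>)"
    using assms(1) by (simp add: circle_periodic_def)
  then show "dxi u (\<xi> + 2 * pi) = dxi u \<xi>"
    unfolding dxi_def by (simp add: vector_derivative_at)
qed

text \<open>
  The inner product of \<open>\<complex>\<close> as a real vector space is used throughout the energy argument;
  vanishing of the two complex Fourier coefficients yields orthogonality for this inner product too.
\<close>

lemma has_integral_inner_mode:
  assumes "((\<lambda>\<xi>. v \<xi> * of_real (cos \<xi>)) has_integral 0) S"
    and "((\<lambda>\<xi>. v \<xi> * of_real (sin \<xi>)) has_integral 0) S"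
  shows "((\<lambda>\<xi>. v \<xi> \<bullet> mode c d \<xi>) has_integral 0) S"
proof -
  have "((\<lambda>\<xi>. c \<bullet> (v \<xi> * of_real (cos \<xi>))) has_integral c \<bullet> 0) S"
    using has_integral_linear[OF assms(1) bounded_linear_inner_right[of c]] by (simp add: o_def)
  moreover have "((\<lambda>\<xi>. d \<bullet> (v \<xi> * of_real (sin \<xi>))) has_integral d \<bullet> 0) S"
    using has_integral_linear[OF assms(2) bounded_linear_inner_right[of d]] by (simp add: o_def)
  ultimately have "((\<lambda>\<xi>. c \<bullet> (v \<xi> * of_real (cos \<xi>)) + d \<bullet> (v \<xi> * of_real (sin \<xi>))) has_integral c \<bullet> 0 + d \<bullet> 0) S"
    by (rule has_integral_add)
  then show ?thesis
    by (simp add: inner_complex_def mode_def algebra_simps)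
qed

text \<open>
  Here \<open>v\<close> is the component of a solution orthogonal to the plane, at one fixed time, and the
  left-hand side is the time derivative of its squared \<open>L\<^sup>2\<close> norm. The mode in the time derivative
  of \<open>v\<close> is invisible to \<open>v\<close> by orthogonality. Integration by parts turns the diffusion term
  into \<open>- 2 * norm (v' \<xi>) ^ 2\<close>, which absorbs the dependence of \<open>n\<close> on \<open>v'\<close>.
\<close>

lemma energy_dissipation:
  fixes v v' v'' n :: "real \<Rightarrow> complex"
  assumes v: "\<And>\<xi>. (v has_vector_derivative v' \<xi>) (at \<xi>)"
    and v': "\<And>\<xi>. (v' has_vector_derivative v'' \<xi>) (at \<xi>)"
    and cont: "continuous_on UNIV v''" "continuous_on UNIV n"
    and periodic: "circle_periodic v" "circle_periodic v'"
    and orth: "((\<lambda>\<xi>. v \<xi> * of_real (cos \<xi>)) has_integral 0) {0..2 * pi}"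
      "((\<lambda>\<xi>. v \<xi> * of_real (sin \<xi>)) has_integral 0) {0..2 * pi}"
    and n: "\<And>\<xi>. \<xi> \<in> {0..2 * pi} \<Longrightarrow> norm (n \<xi>) \<le> L * (norm (v \<xi>) + norm (v' \<xi>))" "0 \<le> L"
  shows "integral {0..2 * pi} (\<lambda>\<xi>. 2 * (v \<xi> \<bullet> (v'' \<xi> + n \<xi> + mode c d \<xi>)))
     \<le> (2 * L + L\<^sup>2) * integral {0..2 * pi} (\<lambda>\<xi>. v \<xi> \<bullet> v \<xi>)"
proof -
  have cv: "continuous_on S v" for S
    using v by (meson continuous_at_imp_continuous_on has_vector_derivative_continuous)
  have cv': "continuous_on S v'" for S
    using v' by (meson continuous_at_imp_continuous_on has_vector_derivative_continuous)
  have cv'': "continuous_on S v''" and cn: "continuous_on S n" for S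
    using cont continuous_on_subset by blast+
  note cont = cv cv' cv'' cn
  have per: "v (2 * pi) = v 0" "v' (2 * pi) = v' 0"
    using periodic[unfolded circle_periodic_def, THEN spec, of 0] by simp_all
  have "((\<lambda>\<xi>. v \<xi> \<bullet> v'' \<xi> + v' \<xi> \<bullet> v' \<xi>) has_integral
      v (2 * pi) \<bullet> v' (2 * pi) - v 0 \<bullet> v' 0) {0..2 * pi}"
    using bounded_bilinear.has_vector_derivative[OF bounded_bilinear_inner v v']
    by (intro fundamental_theorem_of_calculus) (auto intro: has_vector_derivative_at_within)
  then have parts: "((\<lambda>\<xi>. v \<xi> \<bullet> v'' \<xi> + v' \<xi> \<bullet> v' \<xi>) has_integral 0) {0..2 * pi}"
    by (simp add: per)
  have int: "(\<lambda>\<xi>. 2 * (v \<xi> \<bullet> n \<xi>) - 2 * (v' \<xi> \<bullet> v' \<xi>)) integrable_on {0..2 * pi}"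
    by (intro integrable_continuous_interval continuous_intros cont)
  have "((\<lambda>\<xi>. 2 * (v \<xi> \<bullet> v'' \<xi> + v' \<xi> \<bullet> v' \<xi>) + 2 * (v \<xi> \<bullet> mode c d \<xi>)
      + (2 * (v \<xi> \<bullet> n \<xi>) - 2 * (v' \<xi> \<bullet> v' \<xi>))) has_integral
      (2 * 0 + 2 * 0 + integral {0..2 * pi} (\<lambda>\<xi>. 2 * (v \<xi> \<bullet> n \<xi>) - 2 * (v' \<xi> \<bullet> v' \<xi>)))) {0..2 * pi}"
    by (intro has_integral_add has_integral_mult_right parts has_integral_inner_mode orth
        integrable_integral int)
  then have "integral {0..2 * pi} (\<lambda>\<xi>. 2 * (v \<xi> \<bullet> (v'' \<xi> + n \<xi> + mode c d \<xi>)))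
      = integral {0..2 * pi} (\<lambda>\<xi>. 2 * (v \<xi> \<bullet> n \<xi>) - 2 * (v' \<xi> \<bullet> v' \<xi>))"
    by (intro integral_unique) (simp add: inner_add_right algebra_simps)
  also have "\<dots> \<le> integral {0..2 * pi} (\<lambda>\<xi>. (2 * L + L\<^sup>2) * (v \<xi> \<bullet> v \<xi>))"
  proof (rule integral_le[OF int])
    show "(\<lambda>\<xi>. (2 * L + L\<^sup>2) * (v \<xi> \<bullet> v \<xi>)) integrable_on {0..2 * pi}"
      by (intro integrable_continuous_interval continuous_intros cont)
    fix \<xi> :: real
    assume "\<xi> \<in> {0..2 * pi}"
    then have "v \<xi> \<bullet> n \<xi> \<le> norm (v \<xi>) * (L * (norm (v \<xi>) + norm (v' \<xi>)))"
      using n norm_cauchy_schwarz[of "v \<xi>" "n \<xi>"]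
      by (meson mult_left_mono norm_ge_zero order_trans)
    \<comment> \<open>Young's inequality for the mixed term \<open>2 * L * norm (v \<xi>) * norm (v' \<xi>)\<close>.\<close>
    moreover have "0 \<le> (norm (v' \<xi>) - L * norm (v \<xi>))\<^sup>2 + norm (v' \<xi>) ^ 2"
      by simp
    ultimately show "2 * (v \<xi> \<bullet> n \<xi>) - 2 * (v' \<xi> \<bullet> v' \<xi>) \<le> (2 * L + L\<^sup>2) * (v \<xi> \<bullet> v \<xi>)"
      unfolding power2_norm_eq_inner[symmetric] by (simp add: power2_eq_square algebra_simps)
  qed
  finally show ?thesis
    by simp
qed

text \<open>
  The quantity \<open>E s * exp (- C * s)\<close> does not increase.
\<close>

lemma gronwall_zero:
  fixes E E' :: "real \<Rightarrow> real"
  assumes der: "\<And>s. s \<in> {0..T} \<Longrightarrow> (E has_vector_derivative E' s) (at s within {0..T})"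
    and le: "\<And>s. s \<in> {0..T} \<Longrightarrow> E' s \<le> C * E s"
    and "E 0 = 0" "0 \<le> T"
  shows "E T \<le> 0"
proof -
  have "E T * exp (- C * T) \<le> E 0 * exp (- C * 0)"
  proof (rule DERIV_nonpos_imp_decreasing_open[where f = "\<lambda>s. E s * exp (- C * s)"])
    fix s assume s: "0 < s" "s < T"
    then have "(E has_real_derivative E' s) (at s)"
      using der[of s] at_within_Icc_at[of 0 s T]
      by (simp add: has_real_derivative_iff_has_vector_derivative)
    then have "((\<lambda>s. E s * exp (- C * s)) has_real_derivative (E' s - C * E s) * exp (- C * s)) (at s)"
      by (auto intro!: derivative_eq_intros simp: algebra_simps)
    moreover have "(E' s - C * E s) * exp (- C * s) \<le> 0"
      using le[of s] s by (intro mult_nonpos_nonneg) auto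
    ultimately show "\<exists>y. ((\<lambda>s. E s * exp (- C * s)) has_real_derivative y) (at s) \<and> y \<le> 0"
      by blast
  next
    show "continuous_on {0..T} (\<lambda>s. E s * exp (- C * s))"
      using der by (intro continuous_intros)
        (meson continuous_on_eq_continuous_within has_vector_derivative_continuous)
  qed (use \<open>0 \<le> T\<close> in auto)
  then show ?thesis
    using \<open>E 0 = 0\<close> by (simp add: mult_le_0_iff)
qed

lemma continuous_on_bounded_compact:
  fixes h :: "'a::topological_space \<Rightarrow> complex"
  assumes "continuous_on K h" "compact K"
  shows "\<exists>M\<ge>0. \<forall>z\<in>K. norm (h z) \<le> M"
proof -
  have "bounded (h ` K)"
    using assms compact_continuous_image compact_imp_bounded by blast
  then obtain M where "0 < M" "\<forall>y\<in>h ` K. norm y \<le> M"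
    unfolding bounded_pos by blast
  then show ?thesis
    by (intro exI[of _ M]) auto
qed

lemma continuous_on_weighted:
  fixes F :: "real \<Rightarrow> real \<Rightarrow> complex" and k :: "real \<Rightarrow> complex"
  assumes "continuous_on (S \<times> UNIV) (\<lambda>z. F (fst z) (snd z))" "continuous_on UNIV k"
  shows "continuous_on (S \<times> X) (\<lambda>(s, \<xi>). F s \<xi> * k \<xi>)"
  unfolding split_beta
proof (rule continuous_on_mult)
  show "continuous_on (S \<times> X) (\<lambda>z. F (fst z) (snd z))"
    by (rule continuous_on_subset[OF assms(1)]) auto
  show "continuous_on (S \<times> X) (\<lambda>z. k (snd z))"
    by (rule continuous_on_compose2[OF assms(2)]) (auto intro: continuous_on_snd continuous_on_id)
qed

lemma continuous_on_integral_weight: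
  fixes F :: "real \<Rightarrow> real \<Rightarrow> complex" and k :: "real \<Rightarrow> complex"
  assumes "continuous_on (S \<times> UNIV) (\<lambda>z. F (fst z) (snd z))" "continuous_on UNIV k"
  shows "continuous_on S (\<lambda>s. integral {a..b} (\<lambda>\<xi>. F s \<xi> * k \<xi>))"
  using integral_continuous_on_param[of S a b "\<lambda>s \<xi>. F s \<xi> * k \<xi>"] continuous_on_weighted[OF assms]
  by simp

lemma has_vector_derivative_integral_weight:
  fixes F F' :: "real \<Rightarrow> real \<Rightarrow> complex" and k :: "real \<Rightarrow> complex"
  assumes "convex S"
    and der: "\<And>s \<xi>. s \<in> S \<Longrightarrow> ((\<lambda>s. F s \<xi>) has_vector_derivative F' s \<xi>) (at s within S)"
    and cont: "\<And>s. s \<in> S \<Longrightarrow> continuous_on {a..b} (F s)"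
    and cont': "continuous_on (S \<times> UNIV) (\<lambda>z. F' (fst z) (snd z))"
    and k: "continuous_on UNIV k" and s: "s \<in> S"
  shows "((\<lambda>s. integral {a..b} (\<lambda>\<xi>. F s \<xi> * k \<xi>)) has_vector_derivative
    integral {a..b} (\<lambda>\<xi>. F' s \<xi> * k \<xi>)) (at s within S)"
proof -
  have "((\<lambda>s. integral (cbox a b) (\<lambda>\<xi>. F s \<xi> * k \<xi>)) has_vector_derivative
    integral (cbox a b) (\<lambda>\<xi>. F' s \<xi> * k \<xi>)) (at s within S)"
  proof (rule leibniz_rule_vector_derivative)
    show "continuous_on (S \<times> cbox a b) (\<lambda>(s, \<xi>). F' s \<xi> * k \<xi>)"
      by (rule continuous_on_weighted[OF cont' k])
    show "(\<lambda>\<xi>. F s \<xi> * k \<xi>) integrable_on cbox a b" if "s \<in> S" for s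
      unfolding cbox_interval using cont[OF that] continuous_on_subset[OF k]
      by (intro integrable_continuous_interval continuous_on_mult) auto
    show "((\<lambda>s. F s \<xi> * k \<xi>) has_vector_derivative F' s \<xi> * k \<xi>) (at s within S)"
      if "s \<in> S" for s \<xi>
      by (intro has_vector_derivative_mult_left der that)
  qed fact+
  then show ?thesis
    by simp
qed

text \<open>
  Both notions of time are served by following the solution along a horizontal segment in the time
  set, where it is an ordinary solution in real time. With \<open>(A s, B s)\<close> the Fourier coefficients of
  the solution, \<open>V\<close> is its component orthogonal to the plane. Comparing with the projected
  function itself, instead of with a solution of the planar equation, avoids any appeal to an existence
  theorem: because the plane is invariant under the right-hand side, the time derivative of \<open>V\<close>
  consists of diffusion, a term controlled by \<open>V\<close> and its derivative, and a pure mode, to which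
  \<open>V\<close> is orthogonal.
\<close>

lemma X1_invariant_forward:
  assumes sol: "pde_solution (nonlin f g) D w"
    and path: "\<And>s. s \<in> {0..T} \<Longrightarrow> t0 + of_real s \<in> D" and "0 \<le> T"
    and init: "w t0 \<in> X1"
  shows "w (t0 + of_real T) \<in> X1"
proof -
  let ?J = "{0..2 * pi}" and ?S = "{0..T}"
  define W where "W s = w (t0 + of_real s)" for s
  define W' where "W' s \<xi> = pde_rhs (nonlin f g) (W s) \<xi>" for s \<xi>
  have periodic: "circle_periodic (W s)"
    and dW: "W s differentiable (at \<xi>)" "dxi (W s) differentiable (at \<xi>)" if "s \<in> ?S" for s \<xi>
    using sol path[OF that] by (auto simp: pde_solution_def W_def)
  have transfer: "continuous_on (?S \<times> UNIV) (\<lambda>z. h (t0 + of_real (fst z)) (snd z))"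
    if "continuous_on (D \<times> UNIV) (\<lambda>(t, \<xi>). h t \<xi>)" for h :: "complex \<Rightarrow> real \<Rightarrow> complex"
  proof -
    have "continuous_on (?S \<times> UNIV)
        (\<lambda>z. case (t0 + complex_of_real (fst z), snd z) of (t, \<xi>) \<Rightarrow> h t \<xi>)"
      by (rule continuous_on_compose2[OF that]) (auto intro!: continuous_intros path)
    then show ?thesis
      by simp
  qed
  have cW: "continuous_on (?S \<times> UNIV) (\<lambda>z. W (fst z) (snd z))"
    and cWx: "continuous_on (?S \<times> UNIV) (\<lambda>z. dxi (W (fst z)) (snd z))"
    and cWxx: "continuous_on (?S \<times> UNIV) (\<lambda>z. dxi (dxi (W (fst z))) (snd z))"
    using sol transfer[of w] transfer[of "\<lambda>t. dxi (w t)"] transfer[of "\<lambda>t. dxi (dxi (w t))"]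
    unfolding pde_solution_def W_def by blast+
  have cW': "continuous_on (?S \<times> UNIV) (\<lambda>z. W' (fst z) (snd z))"
    unfolding W'_def pde_rhs_def
    by (intro continuous_on_add cWxx continuous_on_nonlin cW cWx continuous_intros)
  have slice: "continuous_on X (h s)"
    if "continuous_on (?S \<times> UNIV) (\<lambda>z. h (fst z) (snd z))" "s \<in> ?S"
    for h :: "real \<Rightarrow> real \<Rightarrow> complex" and s X
  proof -
    have "continuous_on X (\<lambda>\<xi>. h (fst (s, \<xi>)) (snd (s, \<xi>)))"
      by (rule continuous_on_compose2[OF that(1)]) (use that(2) in \<open>auto intro!: continuous_intros\<close>)
    then show ?thesis by simp
  qed
  have W_deriv: "((\<lambda>s. W s \<xi>) has_vector_derivative W' s \<xi>) (at s within ?S)" if "s \<in> ?S" for s \<xi>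
  proof -
    have "((\<lambda>t. w t \<xi>) has_field_derivative W' s \<xi>) (at (t0 + of_real s) within D)"
      using sol path[OF that] unfolding pde_solution_def W'_def W_def by blast
    then have "((\<lambda>t. w t \<xi>) has_field_derivative W' s \<xi>)
        (at (t0 + of_real s) within (\<lambda>s. t0 + of_real s) ` ?S)"
      by (rule DERIV_subset) (use path in auto)
    moreover have "((\<lambda>s. t0 + complex_of_real s) has_vector_derivative 1) (at s within ?S)"
      using has_vector_derivative_add[OF has_vector_derivative_const[of t0]
          has_vector_derivative_of_real[OF DERIV_ident, of "at s within ?S"]] by simp
    ultimately show ?thesis
      using field_vector_diff_chain_within[where f = "\<lambda>s. t0 + complex_of_real s" and x = s and S = ?S
          and g = "\<lambda>t. w t \<xi>" and f' = 1 and g' = "W' s \<xi>"]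
      unfolding o_def W_def by simp
  qed

  define A where "A s = integral ?J (\<lambda>\<xi>. W s \<xi> * of_real (cos \<xi>)) / of_real pi" for s
  define B where "B s = integral ?J (\<lambda>\<xi>. W s \<xi> * of_real (sin \<xi>)) / of_real pi" for s
  define A' where "A' s = integral ?J (\<lambda>\<xi>. W' s \<xi> * of_real (cos \<xi>)) / of_real pi" for s
  define B' where "B' s = integral ?J (\<lambda>\<xi>. W' s \<xi> * of_real (sin \<xi>)) / of_real pi" for s
  have moments: "((\<lambda>s. integral ?J (\<lambda>\<xi>. W s \<xi> * k \<xi>)) has_vector_derivative
      integral ?J (\<lambda>\<xi>. W' s \<xi> * k \<xi>)) (at s within ?S)"
    if "continuous_on UNIV k" "s \<in> ?S" for k s
    by (intro has_vector_derivative_integral_weight W_deriv slice[OF cW] cW' that convex_real_interval)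
  have trig: "continuous_on UNIV (\<lambda>\<xi>. complex_of_real (cos \<xi>))"
    "continuous_on UNIV (\<lambda>\<xi>. complex_of_real (sin \<xi>))"
    by (intro continuous_intros)+
  have A_deriv: "(A has_vector_derivative A' s) (at s within ?S)"
    and B_deriv: "(B has_vector_derivative B' s) (at s within ?S)" if "s \<in> ?S" for s
    unfolding A_def[abs_def] B_def[abs_def] A'_def B'_def
    using has_vector_derivative_divide[OF moments[OF trig(1) that], of "of_real pi"]
      has_vector_derivative_divide[OF moments[OF trig(2) that], of "of_real pi"]
    by simp_all
  have "continuous_on ?S A'" "continuous_on ?S B'"
    unfolding A'_def[abs_def] B'_def[abs_def]
    by (intro continuous_on_divide continuous_on_integral_weight[OF cW'] trig continuous_on_const; simp)+
  then have cA'fst: "continuous_on (?S \<times> UNIV) (\<lambda>z. A' (fst z))"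
    and cB'fst: "continuous_on (?S \<times> UNIV) (\<lambda>z. B' (fst z))"
    by (auto elim!: continuous_on_compose2 intro!: continuous_intros)
  have cA: "continuous_on ?S A" and cB: "continuous_on ?S B"
    using A_deriv B_deriv
    by (meson continuous_on_eq_continuous_within has_vector_derivative_continuous)+
  have cAfst: "continuous_on (?S \<times> UNIV) (\<lambda>z. A (fst z))"
    and cBfst: "continuous_on (?S \<times> UNIV) (\<lambda>z. B (fst z))"
    by (auto intro!: continuous_on_compose2[OF cA] continuous_on_compose2[OF cB] continuous_intros)

  define V where "V s \<xi> = W s \<xi> - mode (A s) (B s) \<xi>" for s \<xi>
  define V' where "V' s \<xi> = W' s \<xi> - mode (A' s) (B' s) \<xi>" for s \<xi>
  define Vx where "Vx s \<xi> = dxi (W s) \<xi> - mode (B s) (- A s) \<xi>" for s \<xi>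
  define Vxx where "Vxx s \<xi> = dxi (dxi (W s)) \<xi> - mode (- A s) (- B s) \<xi>" for s \<xi>
  define N where "N s \<xi> = nonlin f g \<xi> (W s \<xi>, dxi (W s) \<xi>)
      - nonlin f g \<xi> (mode (A s) (B s) \<xi>, mode (B s) (- A s) \<xi>)" for s \<xi>
  \<comment> \<open>Diffusion of \<open>V\<close>, a term that vanishes with \<open>V\<close> and \<open>Vx\<close>, and a pure mode: subtracting the
    nonlinearity at the projection only changes the mode.\<close>
  have V'_eq: "V' s \<xi> = Vxx s \<xi> + N s \<xi>
      + mode (eval2 f (A s, B s) - A s - A' s) (eval2 g (A s, B s) - B s - B' s) \<xi>" for s \<xi>
    by (simp add: V'_def W'_def pde_rhs_def Vxx_def N_def nonlin_mode) (simp add: mode_def algebra_simps)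
  have cV: "continuous_on (?S \<times> UNIV) (\<lambda>z. V (fst z) (snd z))"
    unfolding V_def mode_def by (intro continuous_intros cW cAfst cBfst)
  have cVxx: "continuous_on (?S \<times> UNIV) (\<lambda>z. Vxx (fst z) (snd z))"
    unfolding Vxx_def mode_def by (intro continuous_intros cWxx cAfst cBfst)
  have cM: "continuous_on (?S \<times> UNIV) (\<lambda>z. mode (A (fst z)) (B (fst z)) (snd z))"
    "continuous_on (?S \<times> UNIV) (\<lambda>z. mode (B (fst z)) (- A (fst z)) (snd z))"
    unfolding mode_def by (intro continuous_intros cAfst cBfst)+
  have cN: "continuous_on (?S \<times> UNIV) (\<lambda>z. N (fst z) (snd z))"
    unfolding N_def by (intro continuous_on_diff continuous_on_nonlin cW cWx cM continuous_intros)
  have cV': "continuous_on (?S \<times> UNIV) (\<lambda>z. V' (fst z) (snd z))"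
    unfolding V'_def mode_def by (intro continuous_intros cW' cA'fst cB'fst)

  define E where "E s = integral ?J (\<lambda>\<xi>. V s \<xi> \<bullet> V s \<xi>)" for s
  define E' where "E' s = integral ?J (\<lambda>\<xi>. 2 * (V s \<xi> \<bullet> V' s \<xi>))" for s
  have V_deriv: "((\<lambda>s. V s \<xi>) has_vector_derivative V' s \<xi>) (at s within ?S)" if "s \<in> ?S" for s \<xi>
    unfolding V_def V'_def mode_def
    by (intro has_vector_derivative_diff has_vector_derivative_add W_deriv has_vector_derivative_mult_left
        A_deriv B_deriv that)
  have E_deriv: "(E has_vector_derivative E' s) (at s within ?S)" if "s \<in> ?S" for s
  proof -
    have "((\<lambda>s. integral (cbox 0 (2 * pi)) (\<lambda>\<xi>. V s \<xi> \<bullet> V s \<xi>)) has_vector_derivative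
      integral (cbox 0 (2 * pi)) (\<lambda>\<xi>. 2 * (V s \<xi> \<bullet> V' s \<xi>))) (at s within ?S)"
    proof (rule leibniz_rule_vector_derivative)
      show "continuous_on (?S \<times> cbox 0 (2 * pi)) (\<lambda>(s, \<xi>). 2 * (V s \<xi> \<bullet> V' s \<xi>))"
        unfolding split_beta
        by (intro continuous_intros continuous_on_subset[OF cV] continuous_on_subset[OF cV']) auto
      show "(\<lambda>\<xi>. V s \<xi> \<bullet> V s \<xi>) integrable_on cbox 0 (2 * pi)" if "s \<in> ?S" for s
        by (intro integrable_continuous continuous_intros slice[OF cV that])
      show "((\<lambda>s. V s \<xi> \<bullet> V s \<xi>) has_vector_derivative 2 * (V s \<xi> \<bullet> V' s \<xi>)) (at s within ?S)"
        if "s \<in> ?S" for s \<xi>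
        using bounded_bilinear.has_vector_derivative[OF bounded_bilinear_inner
            V_deriv[OF that] V_deriv[OF that], of \<xi> \<xi>]
        by (simp add: inner_commute)
    qed (use that in auto)
    then show ?thesis
      by (simp add: E_def[abs_def] E'_def)
  qed

  \<comment> \<open>The polynomial nonlinearity is only locally Lipschitz, so a bound on the compact set swept out
    by the solution comes first.\<close>
  obtain M where M: "M \<ge> 0" "\<And>s \<xi>. s \<in> ?S \<Longrightarrow> \<xi> \<in> ?J \<Longrightarrow>
      norm (W s \<xi>) \<le> M \<and> norm (dxi (W s) \<xi>) \<le> M \<and>
      norm (mode (A s) (B s) \<xi>) \<le> M \<and> norm (mode (B s) (- A s) \<xi>) \<le> M"
  proof -
    have K: "compact (?S \<times> ?J)"
      by (intro compact_Times compact_Icc)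
    have sub: "?S \<times> ?J \<subseteq> ?S \<times> UNIV" by auto
    obtain M1 M2 M3 M4 where "M1 \<ge> 0" "M2 \<ge> 0" "M3 \<ge> 0" "M4 \<ge> 0"
      and 1: "\<forall>z\<in>?S \<times> ?J. norm (W (fst z) (snd z)) \<le> M1"
      and 2: "\<forall>z\<in>?S \<times> ?J. norm (dxi (W (fst z)) (snd z)) \<le> M2"
      and 3: "\<forall>z\<in>?S \<times> ?J. norm (mode (A (fst z)) (B (fst z)) (snd z)) \<le> M3"
      and 4: "\<forall>z\<in>?S \<times> ?J. norm (mode (B (fst z)) (- A (fst z)) (snd z)) \<le> M4"
      using continuous_on_bounded_compact[OF continuous_on_subset[OF cW sub] K]
        continuous_on_bounded_compact[OF continuous_on_subset[OF cWx sub] K]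
        continuous_on_bounded_compact[OF continuous_on_subset[OF cM(1) sub] K]
        continuous_on_bounded_compact[OF continuous_on_subset[OF cM(2) sub] K]
      by blast
    show thesis
    proof (rule that[of "M1 + M2 + M3 + M4"])
      fix s \<xi> assume "s \<in> ?S" "\<xi> \<in> ?J"
      then have z: "(s, \<xi>) \<in> ?S \<times> ?J" by simp
      show "norm (W s \<xi>) \<le> M1 + M2 + M3 + M4 \<and> norm (dxi (W s) \<xi>) \<le> M1 + M2 + M3 + M4 \<and>
        norm (mode (A s) (B s) \<xi>) \<le> M1 + M2 + M3 + M4 \<and>
        norm (mode (B s) (- A s) \<xi>) \<le> M1 + M2 + M3 + M4"
        using bspec[OF 1 z] bspec[OF 2 z] bspec[OF 3 z] bspec[OF 4 z]
          \<open>M1 \<ge> 0\<close> \<open>M2 \<ge> 0\<close> \<open>M3 \<ge> 0\<close> \<open>M4 \<ge> 0\<close>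
        by simp
    qed (use \<open>M1 \<ge> 0\<close> \<open>M2 \<ge> 0\<close> \<open>M3 \<ge> 0\<close> \<open>M4 \<ge> 0\<close> in simp)
  qed
  obtain L where L: "L \<ge> 0" and lipschitz: "\<And>\<xi> p p' q q'.
      norm p \<le> M \<Longrightarrow> norm p' \<le> M \<Longrightarrow> norm q \<le> M \<Longrightarrow> norm q' \<le> M \<Longrightarrow>
      norm (nonlin f g \<xi> (p, q) - nonlin f g \<xi> (p', q')) \<le> L * (norm (p - p') + norm (q - q'))"
    using nonlin_locally_lipschitz[OF M(1)] by metis

  have E'_le: "E' s \<le> (2 * L + L\<^sup>2) * E s" if s: "s \<in> ?S" for s
    unfolding E'_def E_def V'_eq
  proof (rule energy_dissipation)
    show "continuous_on UNIV (Vxx s)" "continuous_on UNIV (N s)"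
      using slice[OF cVxx s] slice[OF cN s] by blast+
    show "(V s has_vector_derivative Vx s \<xi>) (at \<xi>)" for \<xi>
      unfolding V_def[abs_def] Vx_def
      using dW(1)[OF s] by (intro has_vector_derivative_diff mode_has_vector_derivative)
        (simp add: dxi_def vector_derivative_works)
    show "(Vx s has_vector_derivative Vxx s \<xi>) (at \<xi>)" for \<xi>
      unfolding Vx_def[abs_def] Vxx_def
      using dW(2)[OF s] by (intro has_vector_derivative_diff mode_has_vector_derivative)
        (simp add: dxi_def[of "dxi (W s)"] vector_derivative_works)
    show "circle_periodic (V s)" "circle_periodic (Vx s)"
      using periodic[OF s] circle_periodic_dxi[OF periodic[OF s] dW(1)[OF s]] circle_periodic_mode
      by (simp_all add: circle_periodic_def V_def Vx_def)
    have "((\<lambda>\<xi>. W s \<xi> * of_real (cos \<xi>)) has_integral A s * of_real pi) ?J"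
      "((\<lambda>\<xi>. W s \<xi> * of_real (sin \<xi>)) has_integral B s * of_real pi) ?J"
      unfolding A_def B_def
      by (auto intro!: integrable_integral integrable_continuous_interval continuous_intros slice[OF cW s])
    from has_integral_diff[OF this(1) mode_mult_cos_has_integral[of "A s" "B s"]]
      has_integral_diff[OF this(2) mode_mult_sin_has_integral[of "A s" "B s"]]
    show "((\<lambda>\<xi>. V s \<xi> * of_real (cos \<xi>)) has_integral 0) ?J"
      "((\<lambda>\<xi>. V s \<xi> * of_real (sin \<xi>)) has_integral 0) ?J"
      by (simp_all add: V_def left_diff_distrib)
    show "norm (N s \<xi>) \<le> L * (norm (V s \<xi>) + norm (Vx s \<xi>))" if "\<xi> \<in> ?J" for \<xi>
      unfolding N_def V_def Vx_def using M(2)[OF s that] by (intro lipschitz) auto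
  qed (rule L)

  obtain a b where ab: "W 0 = mode a b"
    using init by (auto simp: X1_eq_range_mode W_def)
  then have "A 0 = a" "B 0 = b"
    using mode_mult_cos_has_integral[of a b] mode_mult_sin_has_integral[of a b]
    by (simp_all add: A_def B_def integral_unique)
  then have "E 0 = 0"
    by (simp add: E_def V_def ab)
  from gronwall_zero[OF E_deriv E'_le this \<open>0 \<le> T\<close>] have "E T \<le> 0" .
  moreover have T: "T \<in> ?S"
    using \<open>0 \<le> T\<close> by simp
  moreover have cVV: "continuous_on ?J (\<lambda>\<xi>. V T \<xi> \<bullet> V T \<xi>)"
    by (intro continuous_intros slice[OF cV T])
  moreover have "0 \<le> E T"
    unfolding E_def by (rule integral_nonneg) (auto intro: integrable_continuous_interval cVV)
  ultimately have "\<forall>\<xi>\<in>?J. V T \<xi> \<bullet> V T \<xi> = 0"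
    using integral_eq_0_iff[OF cVV] by (simp add: E_def)
  then have "W T = mode (A T) (B T)"
    by (intro circle_periodic_eqI periodic T circle_periodic_mode) (auto simp: V_def)
  then show ?thesis
    by (auto simp: W_def intro: mode_in_X1)
qed

section \<open>Invariance of the plane\<close>

lemma X1_invariant_real_time:
  assumes sol: "pde_solution (nonlin f g) (complex_of_real ` I) w"
    and "is_interval I" "t0 \<in> I" "t \<in> I" "t0 \<le> t" and init: "w (of_real t0) \<in> X1"
  shows "w (of_real t) \<in> X1"
proof -
  have "w (of_real t0 + of_real (t - t0)) \<in> X1"
  proof (rule X1_invariant_forward[OF sol _ _ init])
    fix s assume "s \<in> {0..t - t0}"
    then have "t0 + s \<in> I"
      using mem_is_interval_1_I[OF \<open>is_interval I\<close> \<open>t0 \<in> I\<close> \<open>t \<in> I\<close>] by simp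
    then show "of_real t0 + of_real s \<in> complex_of_real ` I"
      unfolding of_real_add[symmetric] by (rule imageI)
  qed (use \<open>t0 \<le> t\<close> in simp)
  then show ?thesis
    by simp
qed

text \<open>
  Forward uniqueness on a short horizontal segment from \<open>t0\<close> spreads to all of \<open>D\<close>, also backwards
  in time, because solutions are holomorphic in time. Membership in the plane is expressed by
  point values, \<open>u \<xi> = u 0 * cos \<xi> + u (pi / 2) * sin \<xi>\<close>, so the identity theorem applies
  to one scalar function of time for each \<open>\<xi>\<close>.
\<close>

lemma X1_invariant_complex_time:
  assumes sol: "pde_solution (nonlin f g) D w"
    and "open D" "connected D" "t0 \<in> D" "t \<in> D" and init: "w t0 \<in> X1"
  shows "w t \<in> X1"
proof -
  obtain e where e: "e > 0" "cball t0 e \<subseteq> D"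
    using \<open>open D\<close> \<open>t0 \<in> D\<close> open_contains_cball by blast
  define U where "U = (\<lambda>s. t0 + complex_of_real s) ` {0..e}"
  have "t0 + of_real s \<in> cball t0 e" if "s \<in> {0..e}" for s
    using that by (simp add: dist_norm)
  then have path: "t0 + of_real s \<in> D" if "s \<in> {0..e}" for s
    using that e(2) by blast
  have U_X1: "w z \<in> X1" if z: "z \<in> U" for z
  proof -
    obtain s where s: "z = t0 + of_real s" "0 \<le> s" "s \<le> e"
      using z by (auto simp: U_def)
    show ?thesis
      unfolding s(1) by (rule X1_invariant_forward[OF sol _ s(2) init]) (use path s in auto)
  qed
  have limit: "t0 islimpt U"
    unfolding islimpt_approachable
  proof (intro allI impI)
    fix d :: real assume "d > 0"
    then show "\<exists>z\<in>U. z \<noteq> t0 \<and> dist z t0 < d"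
      using e(1) unfolding U_def
      by (intro bexI[of _ "t0 + of_real (min e (d / 2))"] imageI)
        (auto simp: dist_norm simp del: of_real_divide)
  qed
  define h where "h \<xi> z = w z \<xi> - mode (w z 0) (w z (pi / 2)) \<xi>" for \<xi> z
  have holo_w: "(\<lambda>z. w z \<xi>) holomorphic_on D" for \<xi>
    using sol unfolding pde_solution_def holomorphic_on_def field_differentiable_def by blast
  have holo: "h \<xi> holomorphic_on D" for \<xi>
    unfolding h_def[abs_def] mode_def by (intro holomorphic_intros holo_w)
  have zero: "h \<xi> z = 0" if "z \<in> U" for \<xi> z
    using U_X1[OF that] by (auto simp: X1_eq_range_mode h_def mode_0 mode_pi_half)
  have h_t: "h \<xi> t = 0" for \<xi>
  proof (rule analytic_continuation[OF holo \<open>open D\<close> \<open>connected D\<close>])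
    show "U \<subseteq> D"
      using path by (auto simp: U_def)
  qed (use zero limit \<open>t0 \<in> D\<close> \<open>t \<in> D\<close> in auto)
  have "w t = mode (w t 0) (w t (pi / 2))"
    using h_t[unfolded h_def right_minus_eq] by (rule ext)
  then show ?thesis
    using mode_in_X1 by metis
qed

section \<open>Solutions in the plane and their blow-up\<close>

text \<open>
  Evaluating a mode at the angles \<open>0\<close> and \<open>pi / 2\<close> recovers its two coefficients, which gives the
  planar equation back from the partial differential equation, on an arbitrary time set.
\<close>

lemma pde_solution_mode_iff:
  "pde_solution (nonlin f g) D (\<lambda>t. mode (x t) (y t)) \<longleftrightarrow>
   ode_solution (\<lambda>(x, y). - x + eval2 f (x, y)) (\<lambda>(x, y). - y + eval2 g (x, y)) D x y"
  (is "?pde \<longleftrightarrow> ?ode")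
proof
  assume ?pde
  then have der: "((\<lambda>s. mode (x s) (y s) \<xi>) has_field_derivative
      mode (- x t + eval2 f (x t, y t)) (- y t + eval2 g (x t, y t)) \<xi>) (at t within D)"
    if "t \<in> D" for t \<xi>
    using that unfolding pde_solution_def pde_rhs_mode by blast
  show ?ode
    unfolding ode_solution_def using der[of _ 0] der[of _ "pi / 2"]
    by (simp add: mode_0 mode_pi_half)
next
  assume ode: ?ode
  then have x: "(x has_field_derivative - x t + eval2 f (x t, y t)) (at t within D)"
    and y: "(y has_field_derivative - y t + eval2 g (x t, y t)) (at t within D)" if "t \<in> D" for t
    using that by (auto simp: ode_solution_def)
  have "continuous_on D x" "continuous_on D y"
    using x y by (meson DERIV_continuous continuous_on_eq_continuous_within)+
  then have cont: "continuous_on (D \<times> (UNIV :: real set)) (\<lambda>z. x (fst z))"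
    "continuous_on (D \<times> (UNIV :: real set)) (\<lambda>z. y (fst z))"
    by (auto elim!: continuous_on_compose2 intro!: continuous_intros)
  have diff: "mode a b differentiable (at \<xi>)" for a b \<xi>
    by (rule differentiableI_vector[OF mode_has_vector_derivative])
  have "((\<lambda>s. mode (x s) (y s) \<xi>) has_field_derivative
      mode (- x t + eval2 f (x t, y t)) (- y t + eval2 g (x t, y t)) \<xi>) (at t within D)"
    if "t \<in> D" for t \<xi>
    unfolding mode_def by (intro DERIV_add DERIV_cmult_right x y that)
  moreover have "continuous_on (D \<times> UNIV) (\<lambda>(t, \<xi>). mode (x t) (y t) \<xi>)"
    "continuous_on (D \<times> UNIV) (\<lambda>(t, \<xi>). mode (y t) (- x t) \<xi>)"
    "continuous_on (D \<times> UNIV) (\<lambda>(t, \<xi>). mode (- x t) (- y t) \<xi>)"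
    unfolding split_beta mode_def by (intro continuous_intros cont)+
  ultimately show ?pde
    unfolding pde_solution_def pde_rhs_mode dxi_mode using diff circle_periodic_mode by blast
qed

lemma norm_mode_le: "norm (mode a b \<xi>) \<le> norm a + norm b"
proof -
  have "norm (mode a b \<xi>) \<le> norm (a * of_real (cos \<xi>)) + norm (b * of_real (sin \<xi>))"
    unfolding mode_def by (rule norm_triangle_ineq)
  also have "\<dots> \<le> norm a + norm b"
    by (intro add_mono) (simp_all add: norm_mult mult_left_le)
  finally show ?thesis .
qed

lemma sup_norm_mode_le: "sup_norm (mode a b) \<le> 2 * norm (a, b)"
proof -
  have "norm (mode a b \<xi>) \<le> 2 * norm (a, b)" for \<xi>
    using norm_mode_le[of a b \<xi>] norm_fst_le[of a b] norm_snd_le[of b a] by simp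
  then show ?thesis
    unfolding sup_norm_def by (intro cSUP_least) auto
qed

lemma norm_le_sup_norm_mode: "norm (a, b) \<le> 2 * sup_norm (mode a b)"
proof -
  have "bdd_above (range (\<lambda>\<xi>. norm (mode a b \<xi>)))"
    using norm_mode_le by (intro bdd_aboveI2)
  then have "norm (mode a b \<xi>) \<le> sup_norm (mode a b)" for \<xi>
    unfolding sup_norm_def by (intro cSUP_upper) auto
  from this[of 0] this[of "pi / 2"] show ?thesis
    using norm_Pair_le[of a b] by (simp add: mode_0 mode_pi_half)
qed

lemma blows_up_mono:
  assumes "blows_up D N T" "c > 0" "\<And>t. t \<in> D \<Longrightarrow> N t \<le> c * N' t"
  shows "blows_up D N' T"
  unfolding blows_up_def
proof (intro allI impI)
  fix r M :: real assume "r > 0"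
  then obtain t where t: "t \<in> D" "dist t T < r" "c * M < N t"
    using assms(1) unfolding blows_up_def by blast
  then have "c * M < c * N' t"
    using assms(3) by fastforce
  then show "\<exists>t\<in>D. dist t T < r \<and> M < N' t"
    using t \<open>c > 0\<close> by auto
qed

text \<open>
  All norms on the plane are equivalent, so blow-up does not depend on the choice of one.
\<close>

lemma blows_up_mode_iff:
  "blows_up D (\<lambda>t. norm (x t, y t)) T \<longleftrightarrow> blows_up D (\<lambda>t. sup_norm (mode (x t) (y t))) T"
  using blows_up_mono[where c = 2] sup_norm_mode_le norm_le_sup_norm_mode
  by (metis (no_types, lifting) zero_less_numeral)

lemma planar_ode_shifted_form:
  "\<exists>f g. (\<forall>x y. eval2 p (x, y) = - x + eval2 f (x, y) \<and> eval2 q (x, y) = - y + eval2 g (x, y))"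
  by (rule exI[of _ "p + [:[:0, 1:]:]"], rule exI[of _ "q + [:0, 1:]"])
    (simp only: eval2_add eval2_fst eval2_snd, simp)

theorem theorem13p1:
  fixes f g :: "complex poly poly"
  shows
    "(\<forall>z. circle_periodic (\<lambda>\<xi>. nonlin f g \<xi> z)) \<and>
     (\<forall>\<xi>. \<exists>P. \<forall>z. nonlin f g \<xi> z = eval2 P z) \<and>
     circle_fun.subspace X1 \<and> circle_fun.dim X1 = 2 \<and>
     (\<forall>I w t0. is_interval I \<and> pde_solution (nonlin f g) (complex_of_real ` I) w \<and>
        t0 \<in> I \<and> w (of_real t0) \<in> X1 \<longrightarrow>
        (\<forall>t\<in>I. t0 \<le> t \<longrightarrow> w (of_real t) \<in> X1)) \<and>
     (\<forall>D w t0. open D \<and> connected D \<and> pde_solution (nonlin f g) D w \<and>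
        t0 \<in> D \<and> w t0 \<in> X1 \<longrightarrow>
        (\<forall>t\<in>D. w t \<in> X1)) \<and>
     (\<forall>u\<in>X1. pde_rhs (nonlin f g) u \<in> X1) \<and>
     (\<forall>a b. pde_rhs (nonlin f g) (mode a b) = proj_X1 (pde_rhs (nonlin f g) (mode a b)) \<and>
        proj_X1 (pde_rhs (nonlin f g) (mode a b)) =
          mode (- a + eval2 f (a, b)) (- b + eval2 g (a, b))) \<and>
     (\<forall>D x y. pde_solution (nonlin f g) D (\<lambda>t. mode (x t) (y t)) \<longleftrightarrow>
        ode_solution (\<lambda>(x, y). - x + eval2 f (x, y)) (\<lambda>(x, y). - y + eval2 g (x, y)) D x y) \<and>
     (\<forall>p q. \<exists>f' g'.
        (\<forall>x y. eval2 p (x, y) = - x + eval2 f' (x, y) \<and>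
               eval2 q (x, y) = - y + eval2 g' (x, y)) \<and>
        (\<forall>D x y. ode_solution (eval2 p) (eval2 q) D x y \<longrightarrow>
           pde_solution (nonlin f' g') D (\<lambda>t. mode (x t) (y t)) \<and>
           (\<forall>t\<in>D. mode (x t) (y t) \<in> X1) \<and>
           (\<forall>T. blows_up D (\<lambda>t. norm (x t, y t)) T \<longleftrightarrow>
                blows_up D (\<lambda>t. sup_norm (mode (x t) (y t))) T)))"
proof (intro conjI allI impI ballI)
  show "circle_periodic (\<lambda>\<xi>. nonlin f g \<xi> z)" for z
    by (rule circle_periodic_nonlin)
  show "\<exists>P. \<forall>z. nonlin f g \<xi> z = eval2 P z" for \<xi>
    by (rule nonlin_polynomial)
  show "circle_fun.subspace X1" "circle_fun.dim X1 = 2"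
    by (rule subspace_X1, rule dim_X1)
  show "w (of_real t) \<in> X1"
    if "is_interval I \<and> pde_solution (nonlin f g) (complex_of_real ` I) w \<and> t0 \<in> I \<and> w (of_real t0) \<in> X1"
      "t \<in> I" "t0 \<le> t" for I w t0 t
    using that X1_invariant_real_time by blast
  show "w t \<in> X1"
    if "open D \<and> connected D \<and> pde_solution (nonlin f g) D w \<and> t0 \<in> D \<and> w t0 \<in> X1"
      "t \<in> D" for D w t0 t
    using that X1_invariant_complex_time by blast
  show "pde_rhs (nonlin f g) u \<in> X1" if "u \<in> X1" for u
  proof -
    obtain a b where "u = mode a b"
      using \<open>u \<in> X1\<close> by (auto simp: X1_eq_range_mode)
    then show ?thesis
      by (simp only: pde_rhs_mode mode_in_X1)
  qed
  show "pde_rhs (nonlin f g) (mode a b) = proj_X1 (pde_rhs (nonlin f g) (mode a b))" for a b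
    by (simp add: pde_rhs_mode proj_X1_mode)
  show "proj_X1 (pde_rhs (nonlin f g) (mode a b)) =
      mode (- a + eval2 f (a, b)) (- b + eval2 g (a, b))" for a b
    by (simp add: pde_rhs_mode proj_X1_mode)
  show "pde_solution (nonlin f g) D (\<lambda>t. mode (x t) (y t)) \<longleftrightarrow>
      ode_solution (\<lambda>(x, y). - x + eval2 f (x, y)) (\<lambda>(x, y). - y + eval2 g (x, y)) D x y" for D x y
    by (rule pde_solution_mode_iff)
next
  fix p q :: "complex poly poly"
  obtain f' g' where fg: "\<forall>x y. eval2 p (x, y) = - x + eval2 f' (x, y) \<and>
      eval2 q (x, y) = - y + eval2 g' (x, y)"
    using planar_ode_shifted_form by blast
  then have "eval2 p = (\<lambda>(x, y). - x + eval2 f' (x, y))" "eval2 q = (\<lambda>(x, y). - y + eval2 g' (x, y))"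
    by (auto simp: fun_eq_iff)
  then have "pde_solution (nonlin f' g') D (\<lambda>t. mode (x t) (y t))"
    if "ode_solution (eval2 p) (eval2 q) D x y" for D x y
    using that by (simp add: pde_solution_mode_iff)
  with fg show "\<exists>f' g'.
      (\<forall>x y. eval2 p (x, y) = - x + eval2 f' (x, y) \<and> eval2 q (x, y) = - y + eval2 g' (x, y)) \<and>
      (\<forall>D x y. ode_solution (eval2 p) (eval2 q) D x y \<longrightarrow>
         pde_solution (nonlin f' g') D (\<lambda>t. mode (x t) (y t)) \<and>
         (\<forall>t\<in>D. mode (x t) (y t) \<in> X1) \<and>
         (\<forall>T. blows_up D (\<lambda>t. norm (x t, y t)) T \<longleftrightarrow>
              blows_up D (\<lambda>t. sup_norm (mode (x t) (y t))) T))"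
    by (intro exI[of _ f'] exI[of _ g']) (simp add: mode_in_X1 blows_up_mode_iff)
qed

end
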